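(* Let $d\ge 3$ and $T\in(0,\infty)$, and let $b:\mathbb{R}\times\mathbb{R}^d\to\mathbb{R}^d$ be a Borel function with $b(t,x)=0$ for $t\notin[0,T]$. Assume that one of the following two conditions holds: (a) $b\in C\big([0,T];L_d(\mathbb{R}^d)\big)$, that is, $b(t,\cdot)\in L_d(\mathbb{R}^d)$ for every $t\in[0,T]$ and $t\mapsto b(t,\cdot)$ is continuous from $[0,T]$ to $L_d(\mathbb{R}^d)$; (b) $b\in L_q\big([0,T];L_p(\mathbb{R}^d)\big)$, that is, $\int_0^T\big(\int_{\mathbb{R}^d}|b(t,x)|^p\,dx\big)^{q/p}\,dt<\infty$, for some $p\in(d,\infty)$, $q\in(2,\infty)$ with $\frac{d}{p}+\frac{2}{q}=1$. Then for every $\varepsilon>0$ there exist $\rho_b\in(0,1)$ and Borel functions $b_M,b_B:\mathbb{R}\times\mathbb{R}^d\to\mathbb{R}^d$ with $b=b_M+b_B$ such that $$ \Big(\frac{1}{\mathrm{Vol}(B)}\int_B|b_M(t,x)|^{d}\,dx\Big)^{1/d}\le \varepsilon\,\rho^{-1} $$ for all $t\in[0,T]$, all $\rho\in(0,\rho_b]$ and all balls $B\subset\mathbb{R}^d$ of radius $\rho$, and $$ \sup_{s\in\mathbb{R}}\int_s^{s+t}\bar b_B^{\,2}(r)\,dr<\infty\quad\text{for every } t>0,\qquad \bar b_B(r):=\sup_{x\in\mathbb{R}^d}|b_B(r,x)|. $$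
   Context: $|\cdot|$ is the Euclidean norm and $\mathrm{Vol}(B)$ is the Lebesgue measure of $B$. $\bar b_B$ takes values in $[0,\infty]$, and it may equal $+\infty$ on a set of times of Lebesgue measure zero. *)

theory Defs
  imports "HOL-Analysis.Analysis"
begin

text \<open>Real powers on \<open>[0,\<infinity>]\<close>; only exponents \<open>a > 0\<close> are meant, so that \<open>\<infinity>\<close> is sent to \<open>\<infinity>\<close>
  and \<open>0\<close> to \<open>0\<close>.\<close>

definition ennreal_powr :: "ennreal \<Rightarrow> real \<Rightarrow> ennreal" where
  "ennreal_powr x a = (if x = \<infinity> then \<infinity> else ennreal (enn2real x powr a))"

text \<open>All integrals below are taken in \<open>[0,\<infinity>]\<close>, so the \<open>L\<^sub>p\<close> norm of a function that
  is not \<open>p\<close>-integrable is \<open>\<infinity>\<close>.\<close>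

definition Lp_norm :: "real \<Rightarrow> ('a::euclidean_space \<Rightarrow> 'b::euclidean_space) \<Rightarrow> ennreal" where
  "Lp_norm p f = ennreal_powr (\<integral>\<^sup>+ x. ennreal (norm (f x) powr p) \<partial>lborel) (1 / p)"

definition in_Lp :: "real \<Rightarrow> ('a::euclidean_space \<Rightarrow> 'b::euclidean_space) \<Rightarrow> bool" where
  "in_Lp p f \<longleftrightarrow> f \<in> borel_measurable borel \<and> Lp_norm p f < \<infinity>"

definition continuous_into_Lp ::
    "real \<Rightarrow> real \<Rightarrow> (real \<Rightarrow> 'a::euclidean_space \<Rightarrow> 'b::euclidean_space) \<Rightarrow> bool" where
  "continuous_into_Lp T p b \<longleftrightarrow>
     (\<forall>t\<in>{0..T}. in_Lp p (b t)) \<and>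
     (\<forall>t\<in>{0..T}. ((\<lambda>s. Lp_norm p (\<lambda>x. b s x - b t x)) \<longlongrightarrow> 0) (at t within {0..T}))"

text \<open>Membership in \<open>L\<^sub>q([0,T]; L\<^sub>p)\<close>, for jointly Borel functions.\<close>

definition in_Lq_Lp ::
    "real \<Rightarrow> real \<Rightarrow> real \<Rightarrow> (real \<Rightarrow> 'a::euclidean_space \<Rightarrow> 'b::euclidean_space) \<Rightarrow> bool" where
  "in_Lq_Lp T q p b \<longleftrightarrow>
     (\<integral>\<^sup>+ t\<in>{0..T}. ennreal_powr (\<integral>\<^sup>+ x. ennreal (norm (b t x) powr p) \<partial>lborel) (q / p) \<partial>lborel) < \<infinity>"

definition avg_norm_on :: "'a::euclidean_space set \<Rightarrow> real \<Rightarrow> ('a \<Rightarrow> 'b::euclidean_space) \<Rightarrow> ennreal" where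
  "avg_norm_on B p f =
     ennreal_powr ((\<integral>\<^sup>+ x\<in>B. ennreal (norm (f x) powr p) \<partial>lborel) / emeasure lborel B) (1 / p)"

text \<open>For Borel \<open>b\<close> this uncountable supremum need not be Borel in \<open>r\<close>, but it is Lebesgue measurable
  (measurable projection). Since \<^const>\<open>nn_integral\<close> is only a lower integral on non-measurable
  functions, the theorem states this measurability explicitly and integrates with respect to
  Lebesgue measure on its complete sigma-algebra.\<close>

definition sup_norm_x :: "(real \<Rightarrow> 'a::euclidean_space \<Rightarrow> 'b::euclidean_space) \<Rightarrow> real \<Rightarrow> ennreal" where
  "sup_norm_x b r = (SUP x. ennreal (norm (b r x)))"

end

theory Submission
  imports Defs
begin

text \<open>The bounded part \<open>b\<^sub>B\<close> is \<open>b\<close> truncated to \<open>|b| \<le> l(t)\<close>. A ball of radius \<open>\<rho>\<close> in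
  dimension \<open>d\<close> has volume \<open>c \<rho>\<^sup>d\<close>, so the Morrey bound holds for every \<open>\<rho>\<close> once the integral of
  \<open>|b(t)|\<^sup>d\<close> over \<open>|b(t)| > l(t)\<close> is at most \<open>K = c \<epsilon>\<^sup>d\<close>. In case (a) the compact set of all \<open>b(t)\<close> in
  \<open>L\<^sub>d\<close> is uniformly integrable, so a constant \<open>l\<close> works. In case (b), with \<open>I(t)\<close> the integral of
  \<open>|b(t)|\<^sup>p\<close>, take \<open>l = (I/K)\<^bsup>1/(p-d)\<^esup>\<close>; the relation between \<open>p\<close> and \<open>q\<close> says exactly that
  \<open>l\<^sup>2\<close> is a multiple of \<open>I\<^bsup>q/p\<^esup>\<close>, which is integrable.\<close>

section \<open>Extended powers and tail integrals\<close>

lemma ennreal_powr_mono: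
  assumes "x \<le> y" "a \<ge> 0"
  shows "ennreal_powr x a \<le> ennreal_powr y a"
proof (cases "y = \<infinity>")
  case False
  then have "x \<noteq> \<infinity>"
    using assms by (auto simp: top_unique)
  moreover have "enn2real x \<le> enn2real y"
    using assms False by (intro enn2real_mono) (auto simp: top.not_eq_extremum)
  ultimately show ?thesis
    using False assms by (auto simp: ennreal_powr_def intro!: ennreal_leI powr_mono2)
qed (simp add: ennreal_powr_def)

lemma ennreal_powr_measurable [measurable]:
  assumes [measurable]: "f \<in> borel_measurable M"
  shows "(\<lambda>x. ennreal_powr (f x) a) \<in> borel_measurable M"
  unfolding ennreal_powr_def by measurable

text \<open>The part of the integral that truncation at height \<open>l\<close> removes. The strict
  inequality makes its domain the exact complement of the region \<open>norm (f x) \<le> l\<close>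
  kept by the truncation.\<close>

definition tail_integral :: "real \<Rightarrow> ('a::euclidean_space \<Rightarrow> 'b::euclidean_space) \<Rightarrow> real \<Rightarrow> ennreal" where
  "tail_integral p f l = (\<integral>\<^sup>+ x\<in>{x. l < norm (f x)}. ennreal (norm (f x) powr p) \<partial>lborel)"

lemma tail_integral_antimono:
  assumes "l \<le> l'"
  shows "tail_integral p f l' \<le> tail_integral p f l"
  unfolding tail_integral_def
  using assms by (intro nn_integral_mono) (auto split: split_indicator)

section \<open>From a tail bound to the splitting\<close>

text \<open>Enlarging the ball to the whole space in the numerator loses nothing essential: the
  volume is \<open>unit_ball_vol d * \<rho> ^ d\<close>, so the quotient is at most
  \<open>(\<epsilon> / \<rho>) ^ d\<close>, whatever the size of \<open>\<rho>\<close>.\<close>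

lemma avg_norm_on_ball_le:
  fixes f :: "'a::euclidean_space \<Rightarrow> 'b::euclidean_space"
  assumes "\<rho> > 0" "\<epsilon> > 0"
    and int: "(\<integral>\<^sup>+ x. ennreal (norm (f x) powr real DIM('a)) \<partial>lborel)
           \<le> ennreal (unit_ball_vol (real DIM('a)) * \<epsilon> ^ DIM('a))"
  shows "avg_norm_on (ball x\<^sub>0 \<rho>) (real DIM('a)) f \<le> ennreal (\<epsilon> / \<rho>)"
proof -
  let ?d = "DIM('a)" and ?c = "unit_ball_vol (real DIM('a))"
  have c: "?c > 0" by simp
  have "(\<integral>\<^sup>+ x\<in>ball x\<^sub>0 \<rho>. ennreal (norm (f x) powr real ?d) \<partial>lborel)
      \<le> (\<integral>\<^sup>+ x. ennreal (norm (f x) powr real ?d) \<partial>lborel)"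
    by (intro nn_integral_mono) (auto split: split_indicator)
  then have "(\<integral>\<^sup>+ x\<in>ball x\<^sub>0 \<rho>. ennreal (norm (f x) powr real ?d) \<partial>lborel) / emeasure lborel (ball x\<^sub>0 \<rho>)
      \<le> ennreal (?c * \<epsilon> ^ ?d) / ennreal (?c * \<rho> ^ ?d)"
    using int \<open>\<rho> > 0\<close> by (simp add: emeasure_ball divide_right_mono_ennreal)
  also have "\<dots> = ennreal ((\<epsilon> / \<rho>) ^ ?d)"
    using assms less_imp_neq[OF c] by (subst divide_ennreal) (auto simp: power_divide)
  finally have "avg_norm_on (ball x\<^sub>0 \<rho>) (real ?d) f \<le> ennreal_powr (ennreal ((\<epsilon> / \<rho>) ^ ?d)) (1 / real ?d)"
    unfolding avg_norm_on_def by (intro ennreal_powr_mono) auto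
  also have "\<dots> = ennreal (\<epsilon> / \<rho>)"
    using assms by (simp add: ennreal_powr_def powr_powr flip: powr_realpow)
  finally show ?thesis .
qed

text \<open>The set \<open>N\<close> collects the times at which the tail bound may fail. There all
  of \<open>b\<close> is put into \<open>bB\<close>, so \<open>bM\<close> vanishes and its bound
  holds at every \<open>t \<in> S\<close>; the supremum of \<open>bB\<close> is then uncontrolled on
  \<open>N\<close>, but the time integral does not see a null set.\<close>

lemma splitting_of_tail_bound:
  fixes b :: "real \<Rightarrow> 'a::euclidean_space \<Rightarrow> 'b::euclidean_space"
  assumes b [measurable]: "(\<lambda>(t, x). b t x) \<in> borel_measurable borel"
    and l [measurable]: "l \<in> borel_measurable borel" and l0: "\<And>t. l t \<ge> 0"
    and N: "N \<in> null_sets lborel"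
    and l_int: "(\<integral>\<^sup>+ t. ennreal ((l t)\<^sup>2) \<partial>lborel) < \<infinity>"
    and tail: "\<And>t. t \<in> S - N \<Longrightarrow>
      tail_integral (real DIM('a)) (b t) (l t) \<le> ennreal (unit_ball_vol (real DIM('a)) * \<epsilon> ^ DIM('a))"
    and "\<epsilon> > 0"
  obtains bM bB :: "real \<Rightarrow> 'a \<Rightarrow> 'b" where
    "(\<lambda>(t, x). bM t x) \<in> borel_measurable borel"
    "(\<lambda>(t, x). bB t x) \<in> borel_measurable borel"
    "\<And>t x. b t x = bM t x + bB t x"
    "\<And>t \<rho> x\<^sub>0. t \<in> S \<Longrightarrow> \<rho> > 0 \<Longrightarrow>
      avg_norm_on (ball x\<^sub>0 \<rho>) (real DIM('a)) (bM t) \<le> ennreal (\<epsilon> / \<rho>)"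
    "sup_norm_x bB \<in> borel_measurable lebesgue"
    "\<And>t. (SUP s. \<integral>\<^sup>+ r\<in>{s..s + t}. (sup_norm_x bB r)\<^sup>2 \<partial>lebesgue) < \<infinity>"
proof -
  obtain e :: 'b where e: "norm e = 1"
    using vector_choose_size[of 1] by auto
  have [measurable]: "N \<in> sets borel" using N by auto
  \<comment> \<open>The value at the Lebesgue-null point \<open>x = 0\<close> makes the supremum over \<open>x\<close> equal to \<open>l t\<close>
    for \<open>t \<notin> N\<close>, so that its measurability does not need the projection theorem.\<close>
  define bB where "bB t x = (if t \<in> N then b t x else if x = 0 then l t *\<^sub>R e
      else if norm (b t x) \<le> l t then b t x else 0)" for t x
  define bM where "bM t x = b t x - bB t x" for t x
  have b2 [measurable]: "(\<lambda>z. b (fst z) (snd z)) \<in> borel_measurable (borel \<Otimes>\<^sub>M borel)"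
    using b[folded borel_prod] by (simp add: case_prod_beta')
  have bB_m: "(\<lambda>z. bB (fst z) (snd z)) \<in> borel_measurable (borel \<Otimes>\<^sub>M borel)"
    unfolding bB_def by measurable
  have bM_m: "(\<lambda>z. bM (fst z) (snd z)) \<in> borel_measurable (borel \<Otimes>\<^sub>M borel)"
    unfolding bM_def using bB_m by measurable
  have sup: "sup_norm_x bB t = ennreal (l t)" if "t \<notin> N" for t
    unfolding sup_norm_x_def
  proof (intro antisym SUP_least)
    fix x show "ennreal (norm (bB t x)) \<le> ennreal (l t)"
      using that l0[of t] e by (auto simp: bB_def intro!: ennreal_leI)
    show "ennreal (l t) \<le> (SUP x. ennreal (norm (bB t x)))"
      using that l0[of t] e by (intro SUP_upper2[of 0]) (auto simp: bB_def)
  qed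
  have Nl: "N \<in> null_sets lebesgue" using N by (rule null_sets_completionI)
  have ae: "AE t in lebesgue. ennreal (l t) = sup_norm_x bB t"
    using Nl by (rule AE_I') (use sup in force)
  have l_leb: "(\<lambda>t. ennreal (l t)) \<in> borel_measurable lebesgue"
    by (rule measurable_completion) simp
  \<comment> \<open>Lebesgue measure is complete: each preimage differs from the one under the
    measurable function \<open>l\<close> only inside a null set.\<close>
  have sup_m: "sup_norm_x bB \<in> borel_measurable lebesgue"
  proof (rule measurableI)
    fix A :: "ennreal set" assume "A \<in> sets borel"
    then have sets: "(\<lambda>t. ennreal (l t)) -` A \<inter> space lebesgue \<in> sets lebesgue"
      by (rule measurable_sets[OF l_leb])
    have "AE t in lebesgue. t \<in> (\<lambda>t. ennreal (l t)) -` A \<inter> space lebesgue \<longleftrightarrow>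
        t \<in> sup_norm_x bB -` A \<inter> space lebesgue"
      using ae by eventually_elim simp
    then show "sup_norm_x bB -` A \<inter> space lebesgue \<in> sets lebesgue"
      by (rule completion.in_sets_AE[OF _ sets Int_lower2])
  qed simp
  have sup_int: "(SUP s. \<integral>\<^sup>+ r\<in>{s..s + t}. (sup_norm_x bB r)\<^sup>2 \<partial>lebesgue) < \<infinity>" for t
  proof -
    \<comment> \<open>The integral over the whole line bounds every window, hence a bound uniform in
      \<open>s\<close>.\<close>
    have "(\<integral>\<^sup>+ r\<in>{s..s + t}. (sup_norm_x bB r)\<^sup>2 \<partial>lebesgue) \<le> (\<integral>\<^sup>+ r. ennreal ((l r)\<^sup>2) \<partial>lborel)" for s
    proof -
      have "(\<integral>\<^sup>+ r\<in>{s..s + t}. (sup_norm_x bB r)\<^sup>2 \<partial>lebesgue) \<le> (\<integral>\<^sup>+ r. ennreal ((l r)\<^sup>2) \<partial>lebesgue)"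
      proof (rule nn_integral_mono_AE)
        show "AE r in lebesgue. (sup_norm_x bB r)\<^sup>2 * indicator {s..s + t} r \<le> ennreal ((l r)\<^sup>2)"
          using ae
        proof eventually_elim
          case (elim r)
          have "(sup_norm_x bB r)\<^sup>2 = ennreal ((l r)\<^sup>2)"
            unfolding elim[symmetric] by (simp add: ennreal_power l0)
          then show ?case by (simp split: split_indicator)
        qed
      qed
      also have "\<dots> = (\<integral>\<^sup>+ r. ennreal ((l r)\<^sup>2) \<partial>lborel)"
        by (rule nn_integral_completion)
      finally show ?thesis .
    qed
    then show ?thesis
      using l_int by (meson SUP_least le_less_trans)
  qed
  have avg: "avg_norm_on (ball x\<^sub>0 \<rho>) (real DIM('a)) (bM t) \<le> ennreal (\<epsilon> / \<rho>)"
    if "t \<in> S" "\<rho> > 0" for t \<rho> x\<^sub>0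
  proof (rule avg_norm_on_ball_le[OF \<open>\<rho> > 0\<close> \<open>\<epsilon> > 0\<close>], cases "t \<in> N")
    case True
    then show "(\<integral>\<^sup>+ x. ennreal (norm (bM t x) powr real DIM('a)) \<partial>lborel)
           \<le> ennreal (unit_ball_vol (real DIM('a)) * \<epsilon> ^ DIM('a))"
      by (simp add: bM_def bB_def)
  next
    case False
    \<comment> \<open>Away from \<open>x = 0\<close>, where \<open>bB\<close> has an artificial
      value, \<open>bM t\<close> is exactly the part of \<open>b t\<close> above height
      \<open>l t\<close>.\<close>
    have "AE x in lborel. x \<noteq> (0::'a)"
      by (rule AE_lborel_singleton)
    then have "AE x in lborel. ennreal (norm (bM t x) powr real DIM('a))
        = ennreal (norm (b t x) powr real DIM('a)) * indicator {x. l t < norm (b t x)} x"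
      by eventually_elim (use False in \<open>auto simp: bM_def bB_def split: split_indicator\<close>)
    then have "(\<integral>\<^sup>+ x. ennreal (norm (bM t x) powr real DIM('a)) \<partial>lborel)
        = tail_integral (real DIM('a)) (b t) (l t)"
      unfolding tail_integral_def by (rule nn_integral_cong_AE)
    then show "(\<integral>\<^sup>+ x. ennreal (norm (bM t x) powr real DIM('a)) \<partial>lborel)
           \<le> ennreal (unit_ball_vol (real DIM('a)) * \<epsilon> ^ DIM('a))"
      using tail[of t] that False by simp
  qed
  show ?thesis
  proof (rule that[of bM bB])
    show "b t x = bM t x + bB t x" for t x
      by (simp add: bM_def)
  qed (use bB_m bM_m sup_m avg sup_int in \<open>simp_all add: borel_prod case_prod_beta'\<close>)
qed

section \<open>Truncation level in the mixed-norm case (b)\<close>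

text \<open>A Chebyshev argument: where \<open>norm (f x)\<close> exceeds \<open>l\<close>, its
  power \<open>r\<close> is at most \<open>l powr (r - p)\<close> times its power \<open>p\<close>.
  The level solves \<open>l powr (p - r) = I / K\<close>, so integration gives
  \<open>K / I * I = K\<close>.\<close>

lemma tail_integral_le_of_higher_moment:
  fixes f :: "'a::euclidean_space \<Rightarrow> 'b::euclidean_space"
  assumes [measurable]: "f \<in> borel_measurable borel"
    and p: "r < p" "0 < r" and K: "K > 0"
    and I: "(\<integral>\<^sup>+ x. ennreal (norm (f x) powr p) \<partial>lborel) = ennreal I" "I \<ge> 0"
  shows "tail_integral r f ((I / K) powr (1 / (p - r))) \<le> ennreal K"
\<comment> \<open>For \<open>I = 0\<close> the level is 0 and the factor \<open>K / I\<close> is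
  meaningless, but then \<open>f\<close> vanishes almost everywhere.\<close>
proof (cases "I = 0")
  case True
  then have "AE x in lborel. ennreal (norm (f x) powr p) = 0"
    using I by (subst nn_integral_0_iff_AE[symmetric]) auto
  then have "AE x in lborel. f x = 0"
    by eventually_elim (auto simp: ennreal_eq_0_iff)
  then have "AE x in lborel. ennreal (norm (f x) powr r) * indicator {x. 0 < norm (f x)} x = 0"
    by eventually_elim auto
  then show ?thesis
    using True unfolding tail_integral_def by (subst nn_integral_cong_AE[of _ "\<lambda>_. 0"]) auto
next
  case False
  with I have "I > 0" by simp
  define l where "l = (I / K) powr (1 / (p - r))"
  have l: "l > 0" "l powr (p - r) = I / K"
    using \<open>I > 0\<close> K p by (auto simp: l_def powr_powr)
  have *: "norm (f x) powr r \<le> K / I * norm (f x) powr p" if "l < norm (f x)" for x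
  proof -
    have "I / K \<le> norm (f x) powr (p - r)"
      using that l p by (auto simp flip: l(2) intro!: powr_mono2)
    then have "I / K * norm (f x) powr r \<le> norm (f x) powr (p - r) * norm (f x) powr r"
      by (rule mult_right_mono) simp
    also have "\<dots> = norm (f x) powr p"
      by (simp flip: powr_add)
    finally show ?thesis
      using \<open>I > 0\<close> K by (simp add: field_simps)
  qed
  have "tail_integral r f l \<le> (\<integral>\<^sup>+ x. ennreal (K / I) * ennreal (norm (f x) powr p) \<partial>lborel)"
    unfolding tail_integral_def using * \<open>I > 0\<close> K
    by (intro nn_integral_mono) (auto split: split_indicator simp flip: ennreal_mult' intro!: ennreal_leI)
  also have "\<dots> = ennreal (K / I) * ennreal I"
    by (subst nn_integral_cmult) (auto simp: I)
  also have "\<dots> = ennreal K"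
    using \<open>I > 0\<close> K by (simp flip: ennreal_mult)
  finally show ?thesis by (simp add: l_def)
qed

text \<open>The moment bound is applied at each time separately. The times in \<open>[0,T]\<close>
  with infinite \<open>p\<close>-th moment form the null set \<open>N\<close>, because the mixed
  norm is finite.\<close>

lemma tail_bound_Lq_Lp:
  fixes b :: "real \<Rightarrow> 'a::euclidean_space \<Rightarrow> 'b::euclidean_space"
  assumes b: "(\<lambda>(t, x). b t x) \<in> borel_measurable borel"
    and p: "r < p" and q: "2 < q" and pq: "r / p + 2 / q = 1" and r: "0 < r" and K: "K > 0"
    and int: "in_Lq_Lp T q p b"
  shows "\<exists>l N. l \<in> borel_measurable borel \<and> (\<forall>t. l t \<ge> 0) \<and> N \<in> null_sets lborel \<and>
    (\<integral>\<^sup>+ t. ennreal ((l t)\<^sup>2) \<partial>lborel) < \<infinity> \<and>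
    (\<forall>t\<in>{0..T} - N. tail_integral r (b t) (l t) \<le> ennreal K)"
proof -
  have b2 [measurable]: "(\<lambda>z. b (fst z) (snd z)) \<in> borel_measurable (borel \<Otimes>\<^sub>M borel)"
    using b[folded borel_prod] by (simp add: case_prod_beta')
  have bt: "b t \<in> borel_measurable borel" for t
    by (rule measurable_compose[of "\<lambda>x. (t, x)", OF _ b2, simplified]) simp
  define I where "I t = (\<integral>\<^sup>+ x. ennreal (norm (b t x) powr p) \<partial>lborel)" for t
  \<comment> \<open>The second factor is changed from \<open>borel\<close> to \<open>lborel\<close>,
    which has the same sets, so that measurability of the partial integral \<open>I\<close>
    applies.\<close>
  have "(\<lambda>z. ennreal (norm (b (fst z) (snd z)) powr p)) \<in> borel_measurable (borel \<Otimes>\<^sub>M lborel)"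
    by (subst measurable_cong_sets[OF sets_pair_measure_cong[OF refl sets_lborel] refl]) measurable
  then have I_m [measurable]: "I \<in> borel_measurable borel"
    unfolding I_def by (drule_tac lborel.borel_measurable_nn_integral_fst) simp
  have fin: "(\<integral>\<^sup>+ t. ennreal_powr (I t) (q / p) * indicator {0..T} t \<partial>lborel) < \<infinity>"
    using int by (simp add: in_Lq_Lp_def I_def)
  define N where "N = {t \<in> {0..T}. I t = \<infinity>}"
  have N: "N \<in> null_sets lborel"
  proof -
    have "AE t in lborel. ennreal_powr (I t) (q / p) * indicator {0..T} t \<noteq> \<infinity>"
      using fin by (intro nn_integral_PInf_AE) auto
    then have "AE t in lborel. t \<notin> N"
      by eventually_elim (auto simp: N_def ennreal_powr_def)
    moreover have "N \<in> sets lborel"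
      unfolding N_def by measurable
    ultimately show ?thesis
      by (simp add: AE_iff_null_sets)
  qed
  \<comment> \<open>On \<open>N\<close>, \<open>enn2real\<close> sends the infinite moment to 0, so
    \<open>l\<close> is real-valued everywhere. The indicator restricts it to the times that the
    mixed norm controls.\<close>
  define l where "l t = indicator {0..T} t * (enn2real (I t) / K) powr (1 / (p - r))" for t
  have [measurable]: "l \<in> borel_measurable borel"
    unfolding l_def by measurable
  \<comment> \<open>The scaling relation gives \<open>2 / q = (p - r) / p\<close>; this turns
    \<open>(l t)\<^sup>2\<close> into a multiple of \<open>I t\<close> to the power
    \<open>q / p\<close>.\<close>
  have exps: "2 / (p - r) = q / p"
    using pq p q r by (simp add: field_simps)
  \<comment> \<open>Only an inequality: on \<open>N\<close> the left integrand is 0 and the right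
    one is infinite.\<close>
  have "(\<integral>\<^sup>+ t. ennreal ((l t)\<^sup>2) \<partial>lborel)
      \<le> (\<integral>\<^sup>+ t. ennreal ((1 / K) powr (q / p)) * (ennreal_powr (I t) (q / p) * indicator {0..T} t) \<partial>lborel)"
  proof (intro nn_integral_mono)
    fix t
    have "((enn2real (I t) / K) powr (1 / (p - r)))\<^sup>2 = (enn2real (I t) / K) powr (q / p)"
      by (simp add: power2_eq_square exps flip: powr_add)
    also have "\<dots> = (1 / K) powr (q / p) * enn2real (I t) powr (q / p)"
      using K by (simp add: powr_divide)
    finally have "ennreal (((enn2real (I t) / K) powr (1 / (p - r)))\<^sup>2)
        \<le> ennreal ((1 / K) powr (q / p)) * ennreal_powr (I t) (q / p)"
      using K by (auto simp: ennreal_powr_def ennreal_mult ennreal_mult_top)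
    then show "ennreal ((l t)\<^sup>2)
        \<le> ennreal ((1 / K) powr (q / p)) * (ennreal_powr (I t) (q / p) * indicator {0..T} t)"
      by (auto simp: l_def split: split_indicator)
  qed
  also have "\<dots> = ennreal ((1 / K) powr (q / p)) *
      (\<integral>\<^sup>+ t. ennreal_powr (I t) (q / p) * indicator {0..T} t \<partial>lborel)"
    by (rule nn_integral_cmult) measurable
  also have "\<dots> < \<infinity>"
    using fin by (simp add: ennreal_mult_less_top)
  finally have l_int: "(\<integral>\<^sup>+ t. ennreal ((l t)\<^sup>2) \<partial>lborel) < \<infinity>" .
  have "tail_integral r (b t) (l t) \<le> ennreal K" if "t \<in> {0..T} - N" for t
  proof -
    have "I t = ennreal (enn2real (I t))"
      using that by (simp add: N_def top.not_eq_extremum)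
    then show ?thesis
      using tail_integral_le_of_higher_moment[OF bt p r K, of t "enn2real (I t)"] that
      by (simp add: I_def l_def)
  qed
  then show ?thesis
    using N l_int by (intro exI[of _ l] exI[of _ N]) (auto simp: l_def)
qed

section \<open>Uniform truncation level in the continuous case (a)\<close>

text \<open>Dominated convergence along integer levels: at each \<open>x\<close> the integrand is 0
  as soon as the level reaches \<open>norm (f x)\<close>.\<close>

lemma tail_integral_small:
  fixes f :: "'a::euclidean_space \<Rightarrow> 'b::euclidean_space"
  assumes [measurable]: "f \<in> borel_measurable borel"
    and fin: "(\<integral>\<^sup>+ x. ennreal (norm (f x) powr p) \<partial>lborel) < \<infinity>" and "\<delta> > 0"
  shows "\<exists>l>0. tail_integral p f l < \<delta>"
proof -
  have "(\<lambda>n. tail_integral p f (real n)) \<longlonglongrightarrow> (\<integral>\<^sup>+ x. 0 \<partial>(lborel :: 'a measure))"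
    unfolding tail_integral_def
  proof (rule nn_integral_dominated_convergence[where w = "\<lambda>x. ennreal (norm (f x) powr p)"])
    show "AE x in lborel. (\<lambda>n. ennreal (norm (f x) powr p) * indicator {x. real n < norm (f x)} x) \<longlonglongrightarrow> 0"
    proof (intro AE_I2 tendsto_eventually)
      fix x
      obtain m :: nat where "norm (f x) \<le> real m" using real_arch_simple by blast
      then show "\<forall>\<^sub>F n in sequentially. ennreal (norm (f x) powr p) * indicator {x. real n < norm (f x)} x = 0"
        by (intro eventually_sequentiallyI[of m]) (auto split: split_indicator)
    qed
  qed (use fin in \<open>auto split: split_indicator\<close>)
  then have "\<forall>\<^sub>F n in sequentially. tail_integral p f (real n) < \<delta>"
    using \<open>\<delta> > 0\<close> by (intro order_tendstoD(2)) simp_all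
  then have "\<forall>\<^sub>F n in sequentially. tail_integral p f (real n) < \<delta> \<and> n > 0"
    using eventually_gt_at_top by (rule eventually_conj)
  then obtain n where "tail_integral p f (real n) < \<delta>" "n > 0"
    using eventually_happens'[OF sequentially_bot] by blast
  then show ?thesis
    by (intro exI[of _ "real n"]) simp
qed

text \<open>Makes smallness of tails stable under \<open>L_p\<close> perturbation. Where
  \<open>norm (g x) > 2 * l\<close>, either \<open>g - f\<close> carries at least half of the norm
  of \<open>g\<close>, or \<open>f\<close> does, and then \<open>norm (f x) > l\<close>.\<close>

lemma tail_integral_perturb:
  fixes f g :: "'a::euclidean_space \<Rightarrow> 'b::euclidean_space"
  assumes [measurable]: "f \<in> borel_measurable borel" "g \<in> borel_measurable borel" and "p > 0"
  shows "tail_integral p g (2 * l) \<le> ennreal (2 powr p) *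
    ((\<integral>\<^sup>+ x. ennreal (norm (g x - f x) powr p) \<partial>lborel) + tail_integral p f l)"
proof -
  have "tail_integral p g (2 * l) \<le> (\<integral>\<^sup>+ x. ennreal (2 powr p) * (ennreal (norm (g x - f x) powr p)
      + ennreal (norm (f x) powr p) * indicator {x. l < norm (f x)} x) \<partial>lborel)"
    unfolding tail_integral_def
  proof (intro nn_integral_mono)
    fix x
    have "norm (g x) powr p \<le> 2 powr p * (norm (g x - f x) powr p
        + norm (f x) powr p * indicator {x. l < norm (f x)} x)" if "2 * l < norm (g x)"
    proof (cases "norm (g x) \<le> 2 * norm (g x - f x)")
      case True
      then have "norm (g x) powr p \<le> (2 * norm (g x - f x)) powr p"
        using \<open>p > 0\<close> by (intro powr_mono2) auto
      also have "\<dots> \<le> 2 powr p * (norm (g x - f x) powr p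
        + norm (f x) powr p * indicator {x. l < norm (f x)} x)"
        by (simp add: powr_mult)
      finally show ?thesis .
    next
      case False
      then have *: "norm (g x) \<le> 2 * norm (f x)"
        using norm_triangle_ineq2[of "g x" "f x"] by linarith
      then have "norm (g x) powr p \<le> (2 * norm (f x)) powr p"
        using \<open>p > 0\<close> by (intro powr_mono2) auto
      also have "\<dots> \<le> 2 powr p * (norm (g x - f x) powr p
        + norm (f x) powr p * indicator {x. l < norm (f x)} x)"
        using that * by (simp add: powr_mult)
      finally show ?thesis .
    qed
    then show "ennreal (norm (g x) powr p) * indicator {x. 2 * l < norm (g x)} x
      \<le> ennreal (2 powr p) * (ennreal (norm (g x - f x) powr p)
      + ennreal (norm (f x) powr p) * indicator {x. l < norm (f x)} x)"
      by (auto split: split_indicator simp flip: ennreal_plus ennreal_mult' intro!: ennreal_leI)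
  qed
  also have "\<dots> = ennreal (2 powr p) * ((\<integral>\<^sup>+ x. ennreal (norm (g x - f x) powr p) \<partial>lborel) +
      (\<integral>\<^sup>+ x. ennreal (norm (f x) powr p) * indicator {x. l < norm (f x)} x \<partial>lborel))"
    by (simp add: nn_integral_cmult nn_integral_add)
  finally show ?thesis by (simp add: tail_integral_def)
qed

lemma nn_integral_powr_less_of_Lp_norm_less:
  assumes "Lp_norm p f < ennreal \<eta>" "p > 0"
  shows "(\<integral>\<^sup>+ x. ennreal (norm (f x) powr p) \<partial>lborel) < ennreal (\<eta> powr p)"
proof -
  let ?I = "\<integral>\<^sup>+ x. ennreal (norm (f x) powr p) \<partial>lborel"
  have fin: "?I < \<infinity>" and *: "ennreal (enn2real ?I powr (1 / p)) < ennreal \<eta>"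
    using assms by (auto simp: Lp_norm_def ennreal_powr_def top.not_eq_extremum split: if_splits)
  have "enn2real ?I powr (1 / p) < \<eta>"
    using * by (simp add: ennreal_less_iff)
  then have "(enn2real ?I powr (1 / p)) powr p < \<eta> powr p"
    using \<open>p > 0\<close> by (intro powr_less_mono2) auto
  then have "enn2real ?I < \<eta> powr p"
    using \<open>p > 0\<close> by (simp add: powr_powr)
  then have "ennreal (enn2real ?I) < ennreal (\<eta> powr p)"
    by (simp add: ennreal_less_iff)
  then show ?thesis
    using fin by simp
qed

text \<open>Compactness of \<open>[0,T]\<close>: by the perturbation bound one level serves a
  neighbourhood of each time, and the largest level of a finite subcover serves all times, since
  tails decrease in the level.\<close>

lemma tail_bound_continuous_into_Lp:
  assumes cont: "continuous_into_Lp T p b" and p: "p > 0" and K: "K > 0"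
  shows "\<exists>l\<ge>0. \<forall>t\<in>{0..T}. tail_integral p (b t) l \<le> ennreal K"
proof -
  have m: "b t \<in> borel_measurable borel" and fin: "Lp_norm p (b t) < \<infinity>" if "t \<in> {0..T}" for t
    using cont that by (auto simp: continuous_into_Lp_def in_Lp_def)
  \<comment> \<open>One \<open>\<delta>\<close> is spent on the \<open>L_p\<close> distance to
    \<open>b t\<close>, the other on the tail of \<open>b t\<close>; the perturbation bound then
    totals \<open>K\<close>.\<close>
  define \<delta> where "\<delta> = K / (2 * 2 powr p)"
  have \<delta>: "\<delta> > 0" "2 powr p * (\<delta> + \<delta>) = K"
    using K by (auto simp: \<delta>_def)
  have "\<exists>l U. l > 0 \<and> open U \<and> t \<in> U \<and> (\<forall>s\<in>U \<inter> {0..T}. tail_integral p (b s) l \<le> ennreal K)"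
    if t: "t \<in> {0..T}" for t
  proof -
    have "(\<integral>\<^sup>+ x. ennreal (norm (b t x) powr p) \<partial>lborel) < \<infinity>"
      using fin[OF t] by (auto simp: Lp_norm_def ennreal_powr_def top.not_eq_extremum split: if_splits)
    then obtain l where l: "l > 0" "tail_integral p (b t) l < ennreal \<delta>"
      using tail_integral_small[OF m[OF t]] \<delta> by (metis ennreal_less_zero_iff)
    have "\<forall>\<^sub>F s in at t within {0..T}. Lp_norm p (\<lambda>x. b s x - b t x) < ennreal (\<delta> powr (1 / p))"
      using cont t \<delta> by (intro order_tendstoD(2)[of _ 0]) (auto simp: continuous_into_Lp_def)
    then obtain U where U: "open U" "t \<in> U"
      "\<And>s. s \<in> U \<Longrightarrow> s \<noteq> t \<Longrightarrow> s \<in> {0..T} \<Longrightarrow> Lp_norm p (\<lambda>x. b s x - b t x) < ennreal (\<delta> powr (1 / p))"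
      unfolding eventually_at_topological by blast
    have "tail_integral p (b s) (2 * l) \<le> ennreal K" if s: "s \<in> U" "s \<in> {0..T}" for s
    proof -
      have "(\<integral>\<^sup>+ x. ennreal (norm (b s x - b t x) powr p) \<partial>lborel) \<le> ennreal \<delta>"
      \<comment> \<open>The filter \<open>at t\<close> gives nothing at \<open>s = t\<close>, where
        the difference is 0 anyway.\<close>
      proof (cases "s = t")
        case False
        then have "(\<integral>\<^sup>+ x. ennreal (norm (b s x - b t x) powr p) \<partial>lborel) < ennreal ((\<delta> powr (1 / p)) powr p)"
          using U s p by (intro nn_integral_powr_less_of_Lp_norm_less) auto
        then show ?thesis
          using p \<delta> by (simp add: powr_powr)
      qed simp
      then have "tail_integral p (b s) (2 * l) \<le> ennreal (2 powr p) * (ennreal \<delta> + ennreal \<delta>)"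
        using l(2) by (intro order.trans[OF tail_integral_perturb[OF m[OF t] m[OF s(2)] p]]
            mult_left_mono add_mono) auto
      also have "\<dots> = ennreal K"
        using \<delta> by (simp flip: ennreal_plus ennreal_mult)
      finally show ?thesis .
    qed
    then show ?thesis
      using U l by (intro exI[of _ "2 * l"] exI[of _ U]) auto
  qed
  then obtain l U where lU: "\<And>t. t \<in> {0..T} \<Longrightarrow> l t > 0 \<and> open (U t) \<and> t \<in> U t \<and>
      (\<forall>s\<in>U t \<inter> {0..T}. tail_integral p (b s) (l t) \<le> ennreal K)"
    by metis
  have "compact {0..T}" by simp
  then obtain C where C: "C \<subseteq> {0..T}" "finite C" "{0..T} \<subseteq> (\<Union>c\<in>C. U c)"
    by (rule compactE_image[of _ "{0..T}" U]) (use lU in auto)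
  \<comment> \<open>Inserting 0 gives \<open>L \<ge> 0\<close> and keeps \<open>Max\<close>
    meaningful for empty \<open>C\<close>.\<close>
  define L where "L = Max (insert 0 (l ` C))"
  have "tail_integral p (b t) L \<le> ennreal K" if t: "t \<in> {0..T}" for t
  proof -
    obtain c where c: "c \<in> C" "t \<in> U c" using C t by auto
    then have "l c \<le> L" using C by (auto simp: L_def intro!: Max_ge)
    then have "tail_integral p (b t) L \<le> tail_integral p (b t) (l c)"
      by (rule tail_integral_antimono)
    also have "\<dots> \<le> ennreal K"
      using lU[of c] c C t by blast
    finally show ?thesis .
  qed
  moreover have "L \<ge> 0" using C by (auto simp: L_def)
  ultimately show ?thesis by blast
qed

section \<open>Assembling the two cases\<close>

theorem mainTheorem1:
  fixes b :: "real \<Rightarrow> real ^ 'n::finite \<Rightarrow> real ^ 'n" and T :: real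
  assumes "CARD('n) \<ge> 3"
    and "T > 0"
    and "(\<lambda>(t, x). b t x) \<in> borel_measurable borel"
    and "\<And>t x. t \<notin> {0..T} \<Longrightarrow> b t x = 0"
    and "continuous_into_Lp T (real CARD('n)) b \<or>
         (\<exists>p q. real CARD('n) < p \<and> 2 < q \<and> real CARD('n) / p + 2 / q = 1 \<and> in_Lq_Lp T q p b)"
  shows "\<forall>\<epsilon>>0. \<exists>\<rho>\<^sub>b::real. 0 < \<rho>\<^sub>b \<and> \<rho>\<^sub>b < 1 \<and>
    (\<exists>bM bB :: real \<Rightarrow> real ^ 'n \<Rightarrow> real ^ 'n.
       (\<lambda>(t, x). bM t x) \<in> borel_measurable borel \<and>
       (\<lambda>(t, x). bB t x) \<in> borel_measurable borel \<and>
       (\<forall>t x. b t x = bM t x + bB t x) \<and>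
       (\<forall>t\<in>{0..T}. \<forall>\<rho>\<in>{0<..\<rho>\<^sub>b}. \<forall>x\<^sub>0.
          avg_norm_on (ball x\<^sub>0 \<rho>) (real CARD('n)) (bM t) \<le> ennreal (\<epsilon> / \<rho>)) \<and>
       sup_norm_x bB \<in> borel_measurable lebesgue \<and>
       (\<forall>t>0. (SUP s. \<integral>\<^sup>+ r\<in>{s..s + t}. (sup_norm_x bB r)\<^sup>2 \<partial>lebesgue) < \<infinity>))"
proof (intro allI impI, goal_cases)
  case \<epsilon>: (1 \<epsilon>)
  have d: "real CARD('n) > 0" by simp
  let ?K = "unit_ball_vol (real CARD('n)) * \<epsilon> ^ CARD('n)"
  have K: "?K > 0" using \<epsilon> by simp
  have "\<exists>l N. l \<in> borel_measurable borel \<and> (\<forall>t. l t \<ge> 0) \<and> N \<in> null_sets lborel \<and>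
      (\<integral>\<^sup>+ t. ennreal ((l t)\<^sup>2) \<partial>lborel) < \<infinity> \<and>
      (\<forall>t\<in>{0..T} - N. tail_integral (real CARD('n)) (b t) (l t) \<le> ennreal ?K)"
    using assms(5)
  proof (elim disjE exE conjE)
    assume "continuous_into_Lp T (real CARD('n)) b"
    then obtain c where c: "c \<ge> 0" "\<forall>t\<in>{0..T}. tail_integral (real CARD('n)) (b t) c \<le> ennreal ?K"
      using tail_bound_continuous_into_Lp d K by blast
    \<comment> \<open>The constant level is cut off outside \<open>[0,T]\<close> to make its square
      integrable over the line; no exceptional times occur, so \<open>N\<close> is empty.\<close>
    have "(\<integral>\<^sup>+ t. ennreal ((c * indicator {0..T} t)\<^sup>2) \<partial>lborel)
        = (\<integral>\<^sup>+ t. ennreal (c\<^sup>2) * indicator {0..T} t \<partial>lborel)"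
      by (intro nn_integral_cong) (auto split: split_indicator)
    also have "\<dots> < \<infinity>"
      by (use assms(2) in \<open>simp add: nn_integral_cmult_indicator ennreal_mult_less_top\<close>)
    finally show ?thesis
      using c by (intro exI[of _ "\<lambda>t. c * indicator {0..T} t"] exI[of _ "{}"]) auto
  next
    fix p q
    assume "real CARD('n) < p" "2 < q" "real CARD('n) / p + 2 / q = 1" "in_Lq_Lp T q p b"
    then show ?thesis
      using assms(3) d K by (intro tail_bound_Lq_Lp) auto
  qed
  then obtain l N where lN: "l \<in> borel_measurable borel" "\<And>t. l t \<ge> 0" "N \<in> null_sets lborel"
      "(\<integral>\<^sup>+ t. ennreal ((l t)\<^sup>2) \<partial>lborel) < \<infinity>"
      "\<And>t. t \<in> {0..T} - N \<Longrightarrow> tail_integral (real CARD('n)) (b t) (l t) \<le> ennreal ?K"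
    by blast
  have tail: "tail_integral (real DIM(real ^ 'n)) (b t) (l t)
      \<le> ennreal (unit_ball_vol (real DIM(real ^ 'n)) * \<epsilon> ^ DIM(real ^ 'n))" if "t \<in> {0..T} - N" for t
    using lN(5)[OF that] by simp
  obtain bM bB where s:
    "(\<lambda>(t, x). bM t x) \<in> borel_measurable borel"
    "(\<lambda>(t, x). bB t x) \<in> borel_measurable borel"
    "\<And>t x. b t x = bM t x + bB t x"
    "\<And>t \<rho> x\<^sub>0. t \<in> {0..T} \<Longrightarrow> \<rho> > 0 \<Longrightarrow>
      avg_norm_on (ball x\<^sub>0 \<rho>) (real DIM(real ^ 'n)) (bM t) \<le> ennreal (\<epsilon> / \<rho>)"
    "sup_norm_x bB \<in> borel_measurable lebesgue"
    "\<And>t. (SUP s. \<integral>\<^sup>+ r\<in>{s..s + t}. (sup_norm_x bB r)\<^sup>2 \<partial>lebesgue) < \<infinity>"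
    using splitting_of_tail_bound[OF assms(3) lN(1-4) tail \<epsilon>] by blast
  \<comment> \<open>The bound holds for every positive radius, so \<open>1 / 2\<close> is an
    arbitrary choice of \<open>\<rho>\<^sub>b\<close> in \<open>(0,1)\<close>.\<close>
  have "avg_norm_on (ball x\<^sub>0 \<rho>) (real CARD('n)) (bM t) \<le> ennreal (\<epsilon> / \<rho>)"
    if "t \<in> {0..T}" "\<rho> \<in> {0<..1 / 2}" for t \<rho> x\<^sub>0
    using s(4)[of t \<rho> x\<^sub>0] that by simp
  moreover have "\<forall>t x. b t x = bM t x + bB t x"
    using s(3) by blast
  moreover have "\<forall>t>0. (SUP s. \<integral>\<^sup>+ r\<in>{s..s + t}. (sup_norm_x bB r)\<^sup>2 \<partial>lebesgue) < \<infinity>"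
    using s(6) by blast
  moreover have "0 < (1 / 2 :: real)" "1 / 2 < (1 :: real)"
    by simp_all
  ultimately show ?case
    using s(1,2,5) by blast
qed

end
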